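(* For all integers $r\ge 1$ and $q\ge 3$, the constants $$\kappa_{rq}:=\frac{1}{r!}\int_0^1\frac{\log^r(x)\,\mathrm{Li}_q(x)}{1-x}\,dx$$ satisfy $$\left|\kappa_{rq}-(-1)^r\zeta(q)\left[\zeta(r+1)-1\right]\right|\le \frac{\zeta(q-1)-\zeta(q)}{2^{r+1}} .$$
   Context: For an integer $q$ and $|x|<1$, $\mathrm{Li}_q(x)=\sum_{k\ge 1} x^k/k^q$ is the polylogarithm. $\zeta$ is the Riemann zeta function. *)

theory Defs
  imports "HOL-Analysis.Analysis"
begin

text \<open>The Riemann zeta function on the half-line \<open>s > 1\<close>, given by its Dirichlet series
  (a junk value is returned for \<open>s \<le> 1\<close>).\<close>

definition zeta :: "real \<Rightarrow> real" where
  "zeta s = (\<Sum>k. 1 / real (Suc k) powr s)"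

text \<open>The power series is meaningful for \<open>norm x < 1\<close>.\<close>

definition polylog :: "int \<Rightarrow> 'a :: {real_normed_field, banach} \<Rightarrow> 'a" where
  "polylog q x = (\<Sum>k. x ^ Suc k / of_nat (Suc k) powi q)"

text \<open>The open interval is used because the integrand is not defined at the endpoints,
  which form a null set.\<close>

definition kappa :: "nat \<Rightarrow> int \<Rightarrow> real" where
  "kappa r q = 1 / fact r * (LBINT x:{0<..<1}. ln x ^ r * polylog q x / (1 - x))"

end

theory Submission
  imports Defs "HOL-Real_Asymp.Real_Asymp"
begin

text \<open>For \<open>0 < x < 1\<close> Bernoulli's inequality gives
  \<open>0 \<le> x - x^k \<le> (k - 1) x (1 - x)\<close>. Dividing by \<open>k^q\<close> and summing over \<open>k\<close> yields
  \<open>0 \<le> \<zeta>(q) x - Li\<^sub>q(x) \<le> (\<zeta>(q - 1) - \<zeta>(q)) x (1 - x)\<close>.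
  Multiply by \<open>(- ln x)^r / (1 - x)\<close> and integrate: the claim follows from
  \<open>\<integral> (- ln x)^r x / (1 - x) = r! (\<zeta>(r + 1) - 1)\<close> and
  \<open>\<integral> (- ln x)^r x = r! / 2^(r + 1)\<close> over the unit interval.\<close>

lemma summable_inverse_Suc_power:
  assumes "n \<ge> 2"
  shows "summable (\<lambda>k. 1 / real (Suc k) ^ n)"
proof -
  have "summable (\<lambda>k. inverse (real k ^ n))"
    using inverse_power_summable[OF assms, where 'a = real] by simp
  then have "summable (\<lambda>k. inverse (real (Suc k) ^ n))"
    by (subst summable_Suc_iff)
  then show ?thesis
    by (simp only: inverse_eq_divide)
qed

lemma zeta_of_nat: "zeta (real n) = (\<Sum>k. 1 / real (Suc k) ^ n)"
  unfolding zeta_def by (simp add: powr_realpow del: of_nat_Suc)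

lemma zeta_of_nat_sums:
  assumes "n \<ge> 2"
  shows "(\<lambda>k. 1 / real (Suc k) ^ n) sums zeta (real n)"
  unfolding zeta_of_nat by (rule summable_sums[OF summable_inverse_Suc_power[OF assms]])

lemma polylog_of_nat_sums:
  fixes x :: real
  assumes "n \<ge> 2" and "\<bar>x\<bar> \<le> 1"
  shows "(\<lambda>k. x ^ Suc k / real (Suc k) ^ n) sums polylog (int n) x"
proof -
  have "summable (\<lambda>k. x ^ Suc k / real (Suc k) ^ n)"
  proof (rule summable_comparison_test'[OF summable_inverse_Suc_power[OF assms(1)]])
    fix k
    have "\<bar>x\<bar> ^ Suc k \<le> 1"
      using assms(2) by (intro power_le_one) auto
    then show "norm (x ^ Suc k / real (Suc k) ^ n) \<le> 1 / real (Suc k) ^ n"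
      by (simp add: abs_mult power_abs divide_right_mono del: of_nat_Suc power_Suc)
  qed
  then show ?thesis
    by (simp add: polylog_def summable_sums del: of_nat_Suc power_Suc)
qed

text \<open>All three bounds compare the series term by term. The first two serve to dominate the
  integrand and to fix the sign of the error; the third measures the error, and its factor
  \<open>1 - x\<close> cancels the singularity of \<open>1 / (1 - x)\<close> at 1. The assumption on
  \<open>n\<close> makes the series for \<open>zeta (real (n - 1))\<close> converge.\<close>

lemma polylog_zeta_bounds:
  assumes n: "n \<ge> 3" and x: "0 \<le> x" "x \<le> 1"
  shows "0 \<le> polylog (int n) x"
    and "polylog (int n) x \<le> zeta (real n) * x"
    and "zeta (real n) * x - polylog (int n) x
           \<le> (zeta (real (n - 1)) - zeta (real n)) * (x * (1 - x))"
proof -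
  have Li: "(\<lambda>k. x ^ Suc k / real (Suc k) ^ n) sums polylog (int n) x"
    using n x by (intro polylog_of_nat_sums) auto
  have Z: "(\<lambda>k. 1 / real (Suc k) ^ n * x) sums (zeta (real n) * x)"
    using n by (intro sums_mult2 zeta_of_nat_sums) auto
  \<comment> \<open>Bernoulli is applied to \<open>x ^ k\<close> with increment
    \<open>x - 1\<close>, then multiplied by \<open>x\<close>. Since the series are indexed from 0,
    the factor \<open>real k\<close> is the exponent \<open>Suc k\<close> minus 1.\<close>
  have bernoulli: "x - x ^ Suc k \<le> real k * (x * (1 - x))" for k
  proof -
    have "1 + real k * (x - 1) \<le> (1 + (x - 1)) ^ k"
      using x by (intro Bernoulli_inequality) auto
    then have "x * (1 - x ^ k) \<le> x * (real k * (1 - x))"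
      using x by (intro mult_left_mono) (auto simp: algebra_simps)
    then show ?thesis
      by (simp add: algebra_simps)
  qed
  show "0 \<le> polylog (int n) x"
    using x by (intro sums_le[OF _ sums_zero Li]) auto
  show "polylog (int n) x \<le> zeta (real n) * x"
  proof (rule sums_le[OF _ Li Z])
    fix k
    have "x ^ Suc k \<le> x"
      using x power_decreasing[of 1 "Suc k" x] by simp
    then show "x ^ Suc k / real (Suc k) ^ n \<le> 1 / real (Suc k) ^ n * x"
      by (simp add: divide_right_mono del: of_nat_Suc power_Suc)
  qed
  have D: "(\<lambda>k. 1 / real (Suc k) ^ n * x - x ^ Suc k / real (Suc k) ^ n)
             sums (zeta (real n) * x - polylog (int n) x)"
    by (rule sums_diff[OF Z Li])
  have B: "(\<lambda>k. (1 / real (Suc k) ^ (n - 1) - 1 / real (Suc k) ^ n) * (x * (1 - x)))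
             sums ((zeta (real (n - 1)) - zeta (real n)) * (x * (1 - x)))"
    using n by (intro sums_mult2 sums_diff zeta_of_nat_sums) auto
  show "zeta (real n) * x - polylog (int n) x
           \<le> (zeta (real (n - 1)) - zeta (real n)) * (x * (1 - x))"
  proof (rule sums_le[OF _ D B])
    fix k
    obtain m where m: "n = Suc m"
      using n by (cases n) auto
    have "1 / real (Suc k) ^ n * x - x ^ Suc k / real (Suc k) ^ n
            = (x - x ^ Suc k) / real (Suc k) ^ n"
      by (simp add: diff_divide_distrib del: of_nat_Suc power_Suc)
    also have "\<dots> \<le> (real k * (x * (1 - x))) / real (Suc k) ^ n"
      by (intro divide_right_mono bernoulli) auto
    \<comment> \<open>Reading \<open>k\<close> as \<open>Suc k - 1\<close> splits the coefficient
      into a term of the series for \<open>zeta (real (n - 1))\<close> minus one for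
      \<open>zeta (real n)\<close>.\<close>
    also have "\<dots> = ((real (Suc k) - 1) / real (Suc k) ^ n) * (x * (1 - x))"
      by simp
    also have "(real (Suc k) - 1) / real (Suc k) ^ n = 1 / real (Suc k) ^ (n - 1) - 1 / real (Suc k) ^ n"
      by (simp add: m diff_divide_distrib del: of_nat_Suc)
    finally show "1 / real (Suc k) ^ n * x - x ^ Suc k / real (Suc k) ^ n
      \<le> (1 / real (Suc k) ^ (n - 1) - 1 / real (Suc k) ^ n) * (x * (1 - x))" .
  qed
qed

text \<open>Induction on \<open>r\<close> by integration by parts. The boundary behaviour is stated
  as one-sided limits because the logarithm is unbounded at 0 and the fundamental theorem is later
  applied on the open interval.\<close>

lemma antiderivative_neg_ln_power_times_power:
  "\<exists>F. (\<forall>x>0. (F has_real_derivative (- ln x) ^ r * x ^ m) (at x)) \<and>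
       (F \<longlongrightarrow> 0) (at_right 0) \<and> (F \<longlongrightarrow> fact r / real (Suc m) ^ Suc r) (at_left 1)"
proof (induction r)
  case 0
  have "((\<lambda>x. x ^ Suc m / real (Suc m)) has_real_derivative (- ln x) ^ 0 * x ^ m) (at x)"
    for x :: real
    using DERIV_cdivide[OF DERIV_pow[of "Suc m" x], of "real (Suc m)"]
    by (simp del: of_nat_Suc power_Suc)
  moreover have "((\<lambda>x::real. x ^ Suc m / real (Suc m)) \<longlongrightarrow> 0 ^ Suc m / real (Suc m)) (at_right 0)"
    by (intro tendsto_intros) auto
  moreover have "((\<lambda>x::real. x ^ Suc m / real (Suc m)) \<longlongrightarrow> 1 ^ Suc m / real (Suc m)) (at_left 1)"
    by (intro tendsto_intros) auto
  ultimately show ?case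
    by (intro exI[of _ "\<lambda>x. x ^ Suc m / real (Suc m)"]) (simp del: of_nat_Suc)
next
  case (Suc r)
  then obtain F where F: "\<And>x. x > 0 \<Longrightarrow> (F has_real_derivative (- ln x) ^ r * x ^ m) (at x)"
    and F0: "(F \<longlongrightarrow> 0) (at_right 0)"
    and F1: "(F \<longlongrightarrow> fact r / real (Suc m) ^ Suc r) (at_left 1)"
    by blast
  \<comment> \<open>Integration by parts: \<open>x ^ m\<close> is integrated and the logarithmic
    power differentiated, which leaves \<open>Suc r\<close> times the integral handled by
    \<open>F\<close>.\<close>
  define G where "G = (\<lambda>x. (x ^ Suc m * (- ln x) ^ Suc r + real (Suc r) * F x) / real (Suc m))"
  have "(G has_real_derivative (- ln x) ^ Suc r * x ^ m) (at x)" if "x > 0" for x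
  proof -
    have "((\<lambda>x. x ^ Suc m) has_real_derivative real (Suc m) * x ^ m) (at x)"
      using DERIV_pow[of "Suc m" x] by simp
    moreover have "((\<lambda>x. - ln x) has_real_derivative - (1 / x)) (at x)"
      using that by (auto intro!: derivative_eq_intros)
    then have "((\<lambda>x. (- ln x) ^ Suc r) has_real_derivative
        real (Suc r) * (- (1 / x) * (- ln x) ^ r)) (at x)"
      using DERIV_power[where n = "Suc r"] by force
    ultimately have "(G has_real_derivative
        (real (Suc m) * x ^ m * (- ln x) ^ Suc r
          + real (Suc r) * (- (1 / x) * (- ln x) ^ r) * x ^ Suc m
          + real (Suc r) * ((- ln x) ^ r * x ^ m)) / real (Suc m)) (at x)"
      unfolding G_def by (intro DERIV_cdivide DERIV_add DERIV_mult DERIV_cmult F that)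
    also have "real (Suc r) * (- (1 / x) * (- ln x) ^ r) * x ^ Suc m
        = - (real (Suc r) * ((- ln x) ^ r * x ^ m))"
      using that by simp
    finally show ?thesis
      by (simp del: of_nat_Suc power_Suc add: mult.commute)
  qed
  moreover have "((\<lambda>x::real. x ^ Suc m * (- ln x) ^ Suc r) \<longlongrightarrow> 0) (at_right 0)"
    by real_asymp
  then have "(G \<longlongrightarrow> (0 + real (Suc r) * 0) / real (Suc m)) (at_right 0)"
    unfolding G_def by (intro tendsto_intros F0) auto
  \<comment> \<open>At 1 the boundary term vanishes because \<open>ln 1 = 0\<close> occurs with
    positive exponent; only the contribution of \<open>F\<close> survives and turns
    \<open>fact r\<close> into \<open>fact (Suc r)\<close>.\<close>
  moreover have "(G \<longlongrightarrow> (1 ^ Suc m * (- ln 1) ^ Suc r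
      + real (Suc r) * (fact r / real (Suc m) ^ Suc r)) / real (Suc m)) (at_left 1)"
    unfolding G_def by (intro tendsto_intros F1) auto
  ultimately show ?case
    by (intro exI[of _ G]) (simp add: field_simps)
qed

text \<open>For a nonnegative integrand the fundamental theorem on an open interval yields
  integrability and the value together, from the limits of an antiderivative at the two
  ends.\<close>

lemma
  fixes r m :: nat
  shows integrable_neg_ln_power_times_power:
      "set_integrable lborel {0<..<1} (\<lambda>x::real. (- ln x) ^ r * x ^ m)"
    and integral_neg_ln_power_times_power:
      "(LBINT x:{0<..<1}. (- ln x) ^ r * x ^ m) = fact r / real (Suc m) ^ Suc r"
proof -
  obtain F where F: "\<And>x. x > 0 \<Longrightarrow> (F has_real_derivative (- ln x) ^ r * x ^ m) (at x)"
    and F0: "(F \<longlongrightarrow> 0) (at_right 0)"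
    and F1: "(F \<longlongrightarrow> fact r / real (Suc m) ^ Suc r) (at_left 1)"
    using antiderivative_neg_ln_power_times_power[of r m] by blast
  have F0': "((F \<circ> real_of_ereal) \<longlongrightarrow> 0) (at_right (ereal 0))"
    by (subst ereal_tendsto_simps) (rule F0)
  have F1': "((F \<circ> real_of_ereal) \<longlongrightarrow> fact r / real (Suc m) ^ Suc r) (at_left (ereal 1))"
    by (subst ereal_tendsto_simps) (rule F1)
  have cont: "isCont (\<lambda>x. (- ln x) ^ r * x ^ m) x" if "x > 0" for x :: real
    using that by (intro continuous_intros) auto
  have nonneg: "AE x in lborel. ereal 0 < ereal x \<longrightarrow> ereal x < ereal 1 \<longrightarrow> 0 \<le> (- ln x) ^ r * x ^ m"
    by (auto intro!: AE_I2 mult_nonneg_nonneg zero_le_power)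
  note FTC = interval_integral_FTC_nonneg[where a = "ereal 0" and b = "ereal 1" and F = F
      and f = "\<lambda>x. (- ln x) ^ r * x ^ m", OF _ _ _ nonneg F0' F1']
  show "set_integrable lborel {0<..<1} (\<lambda>x::real. (- ln x) ^ r * x ^ m)"
    using FTC(1) F cont by auto
  show "(LBINT x:{0<..<1}. (- ln x) ^ r * x ^ m) = fact r / real (Suc m) ^ Suc r"
    using FTC(2) F cont by (auto simp: interval_integral_Ioo)
qed

text \<open>Expand \<open>x / (1 - x)\<close> as a geometric series and integrate term by term. The
  terms are nonnegative, so absolute summability of the integrals is just convergence of the zeta
  series at \<open>r + 1\<close>, which holds as \<open>r \<ge> 1\<close>.\<close>

lemma
  fixes r :: nat
  assumes r: "r \<ge> 1"
  shows integrable_neg_ln_power_div: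
      "set_integrable lborel {0<..<1} (\<lambda>x::real. (- ln x) ^ r * (x / (1 - x)))"
    and integral_neg_ln_power_div:
      "(LBINT x:{0<..<1}. (- ln x) ^ r * (x / (1 - x))) = fact r * (zeta (real r + 1) - 1)"
proof -
  \<comment> \<open>The indicator is built into the terms so that the series identity holds at every
    real \<open>x\<close>.\<close>
  define f where "f = (\<lambda>m (x::real). indicator {0<..<1} x *\<^sub>R ((- ln x) ^ r * x ^ Suc m))"
  have int: "integrable lborel (f m)" for m
    using integrable_neg_ln_power_times_power[of r "Suc m"]
    unfolding f_def set_integrable_def .
  have nonneg: "f m x \<ge> 0" for m x
    by (auto simp: f_def indicator_def)
  have val: "integral\<^sup>L lborel (f m) = fact r * (1 / real (Suc (Suc m)) ^ Suc r)" for m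
    using integral_neg_ln_power_times_power[of r "Suc m"]
    unfolding f_def set_lebesgue_integral_def by simp
  have sums: "(\<lambda>m. f m x) sums (indicator {0<..<1} x *\<^sub>R ((- ln x) ^ r * (x / (1 - x))))" for x
  proof (cases "x \<in> {0<..<1}")
    case True
    then have "(\<lambda>m. (- ln x) ^ r * (x * x ^ m)) sums ((- ln x) ^ r * (x * (1 / (1 - x))))"
      by (intro sums_mult geometric_sums) auto
    with True show ?thesis
      by (simp add: f_def)
  qed (simp add: f_def)
  \<comment> \<open>The powers of \<open>x\<close> start at exponent 1, so the integrals start at
    \<open>1 / 2 ^ Suc r\<close>: the zeta series without its first term, which is 1.\<close>
  have zeta_tail: "(\<lambda>m. 1 / real (Suc (Suc m)) ^ Suc r) sums (zeta (real r + 1) - 1)"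
    using zeta_of_nat_sums[of "Suc r"] r
    by (subst sums_Suc_iff) (simp add: add.commute)
  then have I: "(\<lambda>m. integral\<^sup>L lborel (f m)) sums (fact r * (zeta (real r + 1) - 1))"
    unfolding val by (rule sums_mult)
  have 1: "AE x in lborel. summable (\<lambda>m. norm (f m x))"
    using sums_summable[OF sums] nonneg by (auto intro!: AE_I2)
  have 2: "summable (\<lambda>m. \<integral>x. norm (f m x) \<partial>lborel)"
    using sums_summable[OF I] nonneg by simp
  have eq: "(\<lambda>x. \<Sum>m. f m x) = (\<lambda>x. indicator {0<..<1} x *\<^sub>R ((- ln x) ^ r * (x / (1 - x))))"
    using sums_unique[OF sums] by auto
  show "set_integrable lborel {0<..<1} (\<lambda>x::real. (- ln x) ^ r * (x / (1 - x)))"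
    using integrable_suminf[OF int 1 2] unfolding eq set_integrable_def .
  show "(LBINT x:{0<..<1}. (- ln x) ^ r * (x / (1 - x))) = fact r * (zeta (real r + 1) - 1)"
    using sums_unique2[OF sums_integral[OF int 1 2] I]
    unfolding eq set_lebesgue_integral_def .
qed

theorem theorem3:
  fixes r :: nat and q :: int
  assumes "r \<ge> 1" and "q \<ge> 3"
  shows "\<bar>kappa r q - (- 1) ^ r * zeta (real_of_int q) * (zeta (real r + 1) - 1)\<bar>
           \<le> (zeta (real_of_int q - 1) - zeta (real_of_int q)) / 2 ^ (r + 1)"
proof -
  define n where "n = nat q"
  have n: "n \<ge> 3" and q: "q = int n"
    using assms(2) by (auto simp: n_def)
  have q_real: "real_of_int q = real n" "real n - 1 = real (n - 1)"
    using n by (auto simp: q)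
  define C where "C = zeta (real (n - 1)) - zeta (real n)"
  \<comment> \<open>Using \<open>- ln x\<close> makes \<open>f\<close>, \<open>g\<close> and
    \<open>h\<close> nonnegative on the unit interval; the sign \<open>(- 1) ^ r\<close> is restored
    at the end.\<close>
  define f where "f = (\<lambda>x::real. (- ln x) ^ r * polylog q x / (1 - x))"
  define g where "g = (\<lambda>x::real. (- ln x) ^ r * (x / (1 - x)))"
  define h where "h = (\<lambda>x::real. (- ln x) ^ r * x ^ 1)"
  note bounds = polylog_zeta_bounds[OF n, folded C_def q]
  have g: "set_integrable lborel {0<..<1} g"
    "(LBINT x:{0<..<1}. g x) = fact r * (zeta (real r + 1) - 1)"
    unfolding g_def using integrable_neg_ln_power_div integral_neg_ln_power_div assms(1) by auto
  have h: "set_integrable lborel {0<..<1} h" "(LBINT x:{0<..<1}. h x) = fact r / 2 ^ Suc r"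
    unfolding h_def using integrable_neg_ln_power_times_power[of r 1]
      integral_neg_ln_power_times_power[of r 1] by auto
  \<comment> \<open>The pointwise polylogarithm bounds are multiplied by the nonnegative weight
    \<open>(- ln x) ^ r / (1 - x)\<close>.\<close>
  have f_bounds: "0 \<le> f x" "f x \<le> zeta (real n) * g x" "zeta (real n) * g x - f x \<le> C * h x"
    if "x \<in> {0<..<1}" for x
  proof -
    have x: "0 \<le> x" "x \<le> 1" "1 - x > 0"
      using that by auto
    have w: "0 \<le> (- ln x) ^ r / (1 - x)"
      using that by simp
    show "0 \<le> f x"
      using mult_nonneg_nonneg[OF w bounds(1)[OF x(1,2)]] by (simp add: f_def)
    show "f x \<le> zeta (real n) * g x"
      using mult_left_mono[OF bounds(2)[OF x(1,2)] w] by (simp add: f_def g_def mult_ac)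
    have "(- ln x) ^ r / (1 - x) * (zeta (real n) * x - polylog q x) = zeta (real n) * g x - f x"
      by (simp add: f_def g_def right_diff_distrib diff_divide_distrib mult_ac)
    moreover have "(- ln x) ^ r / (1 - x) * (C * (x * (1 - x))) = C * h x"
      using x(3) by (simp add: h_def)
    ultimately show "zeta (real n) * g x - f x \<le> C * h x"
      using mult_left_mono[OF bounds(3)[OF x(1,2)] w] by simp
  qed
  have [measurable]: "f \<in> borel_measurable borel"
    unfolding f_def polylog_def by measurable
  have zg: "set_integrable lborel {0<..<1} (\<lambda>x. zeta (real n) * g x)"
    using g(1) by simp
  \<comment> \<open>Integrability follows by domination, since \<open>f\<close> lies between 0 and
    the integrable function \<open>zeta (real n) * g x\<close>.\<close>
  have f: "set_integrable lborel {0<..<1} f"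
    by (rule set_integrable_bound[OF zg])
      (use f_bounds in \<open>force simp: set_borel_measurable_def\<close>)+
  have d: "set_integrable lborel {0<..<1} (\<lambda>x. zeta (real n) * g x - f x)"
    by (rule set_integral_diff(1)[OF zg f])
  define J where "J = (LBINT x:{0<..<1}. f x)"
  define G where "G = fact r * (zeta (real r + 1) - 1)"
  have D: "(LBINT x:{0<..<1}. zeta (real n) * g x - f x) = zeta (real n) * G - J"
    using set_integral_diff(2)[OF zg f] by (simp add: g(2) J_def G_def)
  have "(LBINT x:{0<..<1}. zeta (real n) * g x - f x) \<ge> 0"
    using f_bounds unfolding set_lebesgue_integral_def
    by (intro integral_nonneg_AE AE_I2) (auto simp: indicator_def)
  moreover have "(LBINT x:{0<..<1}. zeta (real n) * g x - f x) \<le> (LBINT x:{0<..<1}. C * h x)"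
    using d h(1) f_bounds by (intro set_integral_mono) auto
  \<comment> \<open>The integral of the difference lies between 0 and the integral of
    \<open>C * h x\<close>, which bounds its absolute value.\<close>
  ultimately have le: "\<bar>J - zeta (real n) * G\<bar> \<le> C * (fact r / 2 ^ Suc r)"
    unfolding D by (simp add: h(2))
  have "ln x ^ r = (- 1) ^ r * (- ln x) ^ r" for x :: real
    by (simp flip: power_mult_distrib)
  then have "(\<lambda>x. ln x ^ r * polylog q x / (1 - x)) = (\<lambda>x. (- 1) ^ r * f x)"
    by (simp only: f_def mult.assoc times_divide_eq_right)
  then have "kappa r q = (- 1) ^ r * (J / fact r)"
    by (simp add: kappa_def J_def)
  then have "kappa r q - (- 1) ^ r * zeta (real n) * (zeta (real r + 1) - 1)
      = (- 1) ^ r * ((J - zeta (real n) * G) / fact r)"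
    by (simp add: G_def field_simps)
  then have "\<bar>kappa r q - (- 1) ^ r * zeta (real n) * (zeta (real r + 1) - 1)\<bar>
      = \<bar>J - zeta (real n) * G\<bar> / fact r"
    by (simp add: abs_mult power_abs)
  also have "\<dots> \<le> C * (fact r / 2 ^ Suc r) / fact r"
    using le by (intro divide_right_mono) auto
  also have "\<dots> = C / 2 ^ (r + 1)"
    by simp
  finally show ?thesis
    unfolding q_real C_def .
qed

end
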